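(* Let $p$ be an odd prime and $g$ a positive integer, both fixed. Then the limits \[ L_e=\lim_{k\to\infty}\frac{\eta_g(\mathbb{F}_p^{2k})}{\sqrt{p^{2k}}} \quad\text{and}\quad L_o=\lim_{k\to\infty}\frac{\eta_g(\mathbb{F}_p^{2k+1})}{\sqrt{p^{2k+1}}} \] both exist and are positive real numbers.
   Context: For an abelian group $G$, a subset $A\subseteq G$ and $d\in G$, let $r_{A-A}(d)=|\{(a,a')\in A\times A: d=a-a'\}|$. For a positive integer $g$, define $\eta_g(G)=\min\{|A| : A\subseteq G,\ r_{A-A}(x)\ge g\text{ for all } x\in G\}$. Here $\mathbb{F}_p^n$ denotes the additive group of the $n$-dimensional vector space over the field with $p$ elements. *)

theory Defs
  imports Complex_Main "HOL-Number_Theory.Residues" "HOL-Algebra.Product_Groups"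
begin

text \<open>
  Abelian groups are HOL-Algebra groups, written multiplicatively:
  the difference \<open>a - a'\<close> is \<open>a \<otimes>\<^bsub>G\<^esub> inv\<^bsub>G\<^esub> a'\<close>.
\<close>

definition diff_rep :: "('a, 'b) monoid_scheme \<Rightarrow> 'a set \<Rightarrow> 'a \<Rightarrow> nat" where
  "diff_rep G A d = card {(a, a'). a \<in> A \<and> a' \<in> A \<and> d = a \<otimes>\<^bsub>G\<^esub> inv\<^bsub>G\<^esub> a'}"

text \<open>
  The infimum of a nonempty set of naturals is its minimum. The set below is empty, and the
  value \<open>0\<close>, if no finite \<open>A\<close> qualifies; for finite \<open>G\<close> this means \<open>order G < g\<close>.
\<close>

definition eta :: "nat \<Rightarrow> ('a, 'b) monoid_scheme \<Rightarrow> nat" where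
  "eta g G = Inf {card A | A. finite A \<and> A \<subseteq> carrier G \<and> (\<forall>x\<in>carrier G. diff_rep G A x \<ge> g)}"

definition Fp_space :: "nat \<Rightarrow> nat \<Rightarrow> (nat \<Rightarrow> int) monoid" where
  "Fp_space p n = product_group {..<n} (\<lambda>_. add_monoid (residue_ring (int p)))"

lemma comm_group_Fp_space:
  assumes "prime p"
  shows "comm_group (Fp_space p n)"
proof -
  interpret residues "int p" "residue_ring (int p)"
    using assms by unfold_locales (simp_all add: prime_gt_Suc_0_nat)
  have gr: "group (Fp_space p n)"
    unfolding Fp_space_def by (rule product_group) (rule a_group)
  show ?thesis
    by (rule group.group_comm_groupI[OF gr])
      (auto simp: Fp_space_def residue_ring_def add.commute fun_eq_iff)
qed

lemma order_Fp_space: "order (Fp_space p n) = p ^ n"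
  by (simp add: Fp_space_def order_def residue_ring_def card_PiE)

end

theory Submission
  imports Defs "HOL-Algebra.Algebraic_Closure"
begin

text \<open>
  Products give \<open>\<eta>\<^sub>g(G \<times> H) \<le> \<eta>\<^sub>g(G) \<eta>\<^sub>1(H)\<close>. Put \<open>q = p\<^sup>m\<close>.
  In the additive group of \<open>GF(q)\<^sup>2\<close> the parabola \<open>{(x, x\<^sup>2)}\<close> represents every difference
  \<open>(a, b)\<close> with \<open>a \<noteq> 0\<close>, and the remaining differences lie in a subgroup of order \<open>q\<close>,
  which is covered by the union of two complementary subgroups of order about \<open>\<surd>q\<close>. Hence
  \<open>\<eta>\<^sub>1(GF(q)\<^sup>2) = (1 + o(1)) q\<close>, so \<open>\<eta>\<^sub>g(F\<^sub>p\<^sup>n) / p\<^bsup>n/2\<^esup>\<close> is nonincreasing along each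
  parity class up to a factor \<open>1 + o(1)\<close> and converges to its infimum over large \<open>n\<close>. The infimum
  is at least \<open>1\<close> because \<open>|A|\<^sup>2 \<ge> p\<^sup>n\<close>.
\<close>

hide_const (open) Divisibility.prime

section \<open>Finite fields\<close>

text \<open>Induction on \<open>n\<close>: multiplying by \<open>x\<close> shifts the index and
  multiplying by \<open>y\<close> keeps it, so Pascal's rule merges the two sums. The natural
  coefficients act by repeated addition, so no map from the integers into the ring is
  involved.\<close>

lemma (in cring) binomial_expansion:
  assumes x: "x \<in> carrier R" and y: "y \<in> carrier R"
  shows "(x \<oplus> y) [^] (n::nat) = (\<Oplus>k\<in>{..n}. [(n choose k)] \<cdot> (x [^] k \<otimes> y [^] (n - k)))"
proof (induction n)
  case 0
  then show ?case by simp
next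
  case (Suc n)
  let ?S = "\<Oplus>k\<in>{..n}. [(n choose k)] \<cdot> (x [^] k \<otimes> y [^] (n - k))"
  let ?f = "\<lambda>k. [(n choose k)] \<cdot> (x [^] k \<otimes> y [^] (Suc n - k))"
  have f: "?f k \<in> carrier R" for k
    using x y by simp
  have X: "x \<otimes> ?S = (\<Oplus>k\<in>{..n}. [(n choose k)] \<cdot> (x [^] Suc k \<otimes> y [^] (n - k)))"
    using x y by (simp add: finsum_rdistr Pi_def add_pow_rdistr m_ac cong: finsum_cong)
  have "y \<otimes> ?S = (\<Oplus>k\<in>{..n}. ?f k)"
  proof -
    have "y \<otimes> ([(n choose k)] \<cdot> (x [^] k \<otimes> y [^] (n - k))) = ?f k" if "k \<le> n" for k
    proof -
      have "y [^] (Suc n - k) = y [^] (n - k) \<otimes> y"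
        using that by (simp add: Suc_diff_le)
      then show ?thesis
        using x y by (simp add: add_pow_rdistr m_ac)
    qed
    then show ?thesis
      using x y by (simp add: finsum_rdistr Pi_def cong: finsum_cong)
  qed
  \<comment> \<open>The added term \<open>k = Suc n\<close> vanishes with its binomial coefficient.
    Splitting off \<open>k = 0\<close> then aligns this sum with the one in
    \<open>X\<close>.\<close>
  also have "\<dots> = (\<Oplus>k\<in>{..Suc n}. ?f k)"
    using finsum_Suc[of ?f n] f x y by (simp add: Pi_def binomial_eq_0)
  also have "\<dots> = (\<Oplus>k\<in>{..n}. [(n choose Suc k)] \<cdot> (x [^] Suc k \<otimes> y [^] (n - k))) \<oplus> y [^] Suc n"
    using finsum_Suc2[of ?f n] f x y by (simp add: Pi_def)
  finally have Y: "y \<otimes> ?S = (\<Oplus>k\<in>{..n}. [(n choose Suc k)] \<cdot> (x [^] Suc k \<otimes> y [^] (n - k))) \<oplus> y [^] Suc n" .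
  have "(x \<oplus> y) [^] Suc n = x \<otimes> ?S \<oplus> y \<otimes> ?S"
    using x y Suc by (simp add: Pi_def m_comm[of _ "x \<oplus> y"] l_distr)
  also have "\<dots> = (\<Oplus>k\<in>{..n}. [(n choose k)] \<cdot> (x [^] Suc k \<otimes> y [^] (n - k)) \<oplus>
      [(n choose Suc k)] \<cdot> (x [^] Suc k \<otimes> y [^] (n - k))) \<oplus> y [^] Suc n"
    unfolding X Y using x y by (subst finsum_addf) (auto simp: Pi_def a_assoc)
  also have "\<dots> = (\<Oplus>k\<in>{..n}. [(Suc n choose Suc k)] \<cdot> (x [^] Suc k \<otimes> y [^] (n - k))) \<oplus> y [^] Suc n"
    using x y by (simp add: add.nat_pow_mult)
  also have "\<dots> = (\<Oplus>k\<in>{..Suc n}. [(Suc n choose k)] \<cdot> (x [^] k \<otimes> y [^] (Suc n - k)))"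
    using x y by (subst finsum_Suc2) (auto simp: Pi_def)
  finally show ?case .
qed

section \<open>Additivity of the Frobenius map in characteristic \<open>p\<close>\<close>

lemma (in cring) add_pow_eq_zero_of_char:
  assumes "[p] \<cdot> \<one> = \<zero>" and "(p::nat) dvd n" and x: "x \<in> carrier R"
  shows "[n] \<cdot> x = \<zero>"
proof -
  obtain k where n: "n = p * k"
    using assms(2) by blast
  have "[p] \<cdot> x = ([p] \<cdot> \<one>) \<otimes> x"
    using x by (simp add: add_pow_ldistr)
  then have "[p] \<cdot> x = \<zero>"
    using assms x by simp
  then show ?thesis
    using add.nat_pow_pow[OF x, of k p] by (simp add: n)
qed

text \<open>The identity \<open>k * (p choose k) = p * ((p - 1) choose (k - 1))\<close> puts
  \<open>p\<close> into the left-hand product, and \<open>p\<close> cannot divide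
  \<open>k\<close>.\<close>

lemma prime_dvd_binomial:
  assumes "prime (p::nat)" "0 < k" "k < p"
  shows "p dvd (p choose k)"
proof -
  have "p dvd k * (p choose k)"
    by (simp add: times_binomial_minus1_eq[OF assms(2)])
  moreover have "\<not> p dvd k"
    using assms by (auto dest: dvd_imp_le)
  ultimately show ?thesis
    using assms(1) prime_dvd_mult_iff by blast
qed

text \<open>In the binomial expansion \<open>p\<close> divides every coefficient except those for
  \<open>k = 0\<close> and \<open>k = p\<close>.\<close>

lemma (in cring) frobenius_add:
  assumes p: "prime (p::nat)" and char: "[p] \<cdot> \<one> = \<zero>"
    and x: "x \<in> carrier R" and y: "y \<in> carrier R"
  shows "(x \<oplus> y) [^] p = x [^] p \<oplus> y [^] p"
proof -
  \<comment> \<open>With \<open>p = Suc m\<close>, the sum over \<open>{..p}\<close> splits into the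
    top term \<open>x [^] p\<close> and a sum over \<open>{..m}\<close>, of which only
    \<open>k = 0\<close> survives.\<close>
  obtain m where m: "p = Suc m"
    using p by (metis not0_implies_Suc not_prime_0)
  let ?f = "\<lambda>k. [(p choose k)] \<cdot> (x [^] k \<otimes> y [^] (p - k))"
  have f: "?f k \<in> carrier R" for k
    using x y by simp
  have "(\<Oplus>k\<in>{..m}. ?f k) = (\<Oplus>k\<in>{..m}. if k = 0 then y [^] p else \<zero>)"
  proof (rule finsum_cong')
    fix k assume "k \<in> {..m}"
    then have "?f k = \<zero>" if "k \<noteq> 0"
      using that p m x y by (intro add_pow_eq_zero_of_char[OF char] prime_dvd_binomial) auto
    then show "?f k = (if k = 0 then y [^] p else \<zero>)"
      using y by simp
  qed (use y in auto)
  also have "\<dots> = y [^] p"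
    using add.finprod_singleton[of 0 "{..m}" "\<lambda>_. y [^] p"] y by (simp add: eq_commute)
  finally have "(\<Oplus>k\<in>{..m}. ?f k) = y [^] p" .
  then show ?thesis
    unfolding binomial_expansion[OF x y, of p] using finsum_Suc[of ?f m] f x y
    by (simp add: m Pi_def)
qed

lemma (in cring) frobenius_power_add:
  assumes p: "prime (p::nat)" and char: "[p] \<cdot> \<one> = \<zero>"
    and x: "x \<in> carrier R" and y: "y \<in> carrier R"
  shows "(x \<oplus> y) [^] (p ^ m) = x [^] (p ^ m) \<oplus> y [^] (p ^ m)"
proof (induction m)
  case 0
  then show ?case using x y by simp
next
  case (Suc m)
  have pow: "z [^] (p ^ Suc m) = (z [^] (p ^ m)) [^] p" if "z \<in> carrier R" for z
    using that by (simp add: nat_pow_pow mult.commute)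
  show ?case
    using x y Suc by (simp add: pow frobenius_add[OF p char] del: power_Suc)
qed

text \<open>Carries the characteristic from the prime field to its algebraic closure, and from there
  to the polynomial ring.\<close>

lemma ring_hom_char:
  assumes "ring R" "ring S" "h \<in> ring_hom R S" and "[(p::nat)] \<cdot>\<^bsub>R\<^esub> \<one>\<^bsub>R\<^esub> = \<zero>\<^bsub>R\<^esub>"
  shows "[p] \<cdot>\<^bsub>S\<^esub> \<one>\<^bsub>S\<^esub> = \<zero>\<^bsub>S\<^esub>"
proof -
  interpret ring_hom_ring R S h
    using assms by (intro ring_hom_ringI2)
  have "h ([n] \<cdot>\<^bsub>R\<^esub> \<one>\<^bsub>R\<^esub>) = [n] \<cdot>\<^bsub>S\<^esub> \<one>\<^bsub>S\<^esub>" for n :: nat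
    by (induction n) simp_all
  then show ?thesis
    using assms(4) by (metis hom_zero)
qed

text \<open>For a root \<open>a\<close> of \<open>X\<^sup>q - X\<close> and \<open>T = X - a\<close>, additivity of Frobenius gives
  \<open>X\<^sup>q - X = T\<^sup>q - T\<close>, which is not divisible by \<open>T\<^sup>2\<close>; so all \<open>q\<close> roots are simple.\<close>

lemma (in algebraically_closed) card_frobenius_fixed_points:
  assumes p: "prime (p::nat)" and char: "[p] \<cdot> \<one> = \<zero>" and "m > 0"
  shows "card {x \<in> carrier L. x [^] (p ^ m) = x} = p ^ m"
proof -
  define q where "q = p ^ m"
  have q: "q > 1"
    unfolding q_def using p \<open>m > 0\<close> by (intro one_less_power prime_gt_1_nat)
  interpret UP: domain "poly_ring L"
    using univ_poly_is_domain[OF carrier_is_subring] .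
  have char_UP: "[p] \<cdot>\<^bsub>poly_ring L\<^esub> \<one>\<^bsub>poly_ring L\<^esub> = \<zero>\<^bsub>poly_ring L\<^esub>"
    using ring_hom_char[OF ring_axioms UP.ring_axioms _ char]
      canonical_embedding_is_hom[OF carrier_is_subring] by simp
  note frob = UP.frobenius_power_add[OF p char_UP, of _ _ m, folded q_def]
  have X: "X \<in> carrier (poly_ring L)"
    using var_closed(1)[OF carrier_is_subring] .
  define P where "P = X [^]\<^bsub>poly_ring L\<^esub> q \<ominus>\<^bsub>poly_ring L\<^esub> X"
  have P: "P \<in> carrier (poly_ring L)"
    unfolding P_def using X by simp
  have degX: "degree X = 1"
    by (simp add: var_def)
  have deg: "degree P = q"
  proof -
    have "degree P = max (degree (X [^]\<^bsub>poly_ring L\<^esub> q)) (degree (\<ominus>\<^bsub>poly_ring L\<^esub> X))"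
      unfolding P_def a_minus_def univ_poly_add
      using X q univ_poly_a_inv_degree[OF carrier_is_subring X] polynomial_pow_degree[OF X, of q] degX
      by (intro poly_add_degree_eq[OF carrier_is_subring]) (auto simp: univ_poly_carrier)
    then show ?thesis
      using q univ_poly_a_inv_degree[OF carrier_is_subring X] polynomial_pow_degree[OF X, of q] degX
      by simp
  qed
  have P0: "P \<noteq> []"
    using deg q by auto
  have ev: "eval P x = x [^] q \<ominus> x" if x: "x \<in> carrier L" for x
  proof -
    interpret E: ring_hom_ring "poly_ring L" L "\<lambda>p. eval p x"
      using eval_is_hom[OF carrier_is_subring x] UP.ring_axioms ring_axioms
      by (intro ring_hom_ringI2)
    show ?thesis
      unfolding P_def a_minus_def using X x by (simp add: E.hom_nat_pow eval_var)
  qed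
  have root: "is_root P x \<longleftrightarrow> x \<in> carrier L \<and> x [^] q = x" for x
    using P0 ev by (auto simp: is_root_def r_right_minus_eq)
  have simple: "count (roots P) a = 1" if "is_root P a" for a
  proof -
    have a: "a \<in> carrier L" and aq: "a [^] q = a"
      using that root by auto
    define T where "T = [\<one>, \<ominus> a]"
    define c where "c = poly_of_const a"
    interpret C: ring_hom_ring L "poly_ring L" poly_of_const
      using canonical_embedding_ring_hom[OF carrier_is_subring] by simp
    have T: "T \<in> carrier (poly_ring L)"
      unfolding T_def using a by (simp add: univ_poly_carrier[symmetric] polynomial_def)
    have c: "c \<in> carrier (poly_ring L)"
      unfolding c_def using a by simp
    have XT: "X = T \<oplus>\<^bsub>poly_ring L\<^esub> c"
      unfolding T_def c_def var_def univ_poly_add poly_of_const_def using a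
      by (auto simp: l_neg)
    have cq: "c [^]\<^bsub>poly_ring L\<^esub> q = c"
      unfolding c_def using C.hom_nat_pow[OF a, of q] aq by simp
    have PT: "P = T [^]\<^bsub>poly_ring L\<^esub> q \<ominus>\<^bsub>poly_ring L\<^esub> T"
      unfolding P_def XT frob[OF T c] cq using T c
      by (simp add: UP.minus_add a_minus_def UP.a_assoc UP.a_lcomm[of c "\<ominus>\<^bsub>poly_ring L\<^esub> T"] UP.r_neg)
    have "\<not> 2 \<le> alg_mult P a"
    proof
      assume "2 \<le> alg_mult P a"
      from le_alg_mult_imp_pdivides[OF a P this]
      have "T [^]\<^bsub>poly_ring L\<^esub> (2::nat) pdivides P"
        by (simp add: T_def)
      then obtain Q where Q: "Q \<in> carrier (poly_ring L)"
        and PQ: "P = T [^]\<^bsub>poly_ring L\<^esub> (2::nat) \<otimes>\<^bsub>poly_ring L\<^esub> Q"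
        by (auto simp: pdivides_def factor_def)
      \<comment> \<open>Writing \<open>q = r + 2\<close> lets one factor \<open>T\<close> be
        cancelled from \<open>T^2 Q = T^q - T\<close>, leaving
        \<open>T Q = T^(r+1) - 1\<close>.\<close>
      obtain r where r: "q = Suc (Suc r)"
        using q less_imp_Suc_add[of 1 q] by auto
      have "T \<otimes>\<^bsub>poly_ring L\<^esub> (T \<otimes>\<^bsub>poly_ring L\<^esub> Q) =
          T \<otimes>\<^bsub>poly_ring L\<^esub> (T [^]\<^bsub>poly_ring L\<^esub> Suc r \<ominus>\<^bsub>poly_ring L\<^esub> \<one>\<^bsub>poly_ring L\<^esub>)"
        using PQ PT T Q unfolding r
        by (simp add: numeral_2_eq_2 a_minus_def UP.r_distr UP.r_minus UP.m_ac)
      moreover have "T \<noteq> \<zero>\<^bsub>poly_ring L\<^esub>"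
        by (simp add: T_def univ_poly_zero)
      ultimately have eq: "T \<otimes>\<^bsub>poly_ring L\<^esub> Q = T [^]\<^bsub>poly_ring L\<^esub> Suc r \<ominus>\<^bsub>poly_ring L\<^esub> \<one>\<^bsub>poly_ring L\<^esub>"
        using T Q by (subst (asm) UP.m_lcancel) auto
      interpret E: ring_hom_ring "poly_ring L" L "\<lambda>p. eval p a"
        using eval_is_hom[OF carrier_is_subring a] UP.ring_axioms ring_axioms
        by (intro ring_hom_ringI2)
      \<comment> \<open>Evaluating the cancelled equation at \<open>a\<close> kills every power of
        \<open>T\<close> and leaves \<open>0 = -1\<close>.\<close>
      have "eval T a = \<zero>"
        using a by (simp add: T_def r_neg)
      then have "\<zero> = \<ominus> \<one>"
        using arg_cong[OF eq, of "\<lambda>p. eval p a"] T Q 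
        by (simp add: a_minus_def E.hom_nat_pow del: eval.simps)
      then show False
        using one_not_zero by (metis minus_minus minus_zero one_closed)
    qed
    moreover have "alg_mult P a > 0"
      using alg_mult_gt_zero_iff_is_root[OF P] that by simp
    ultimately show ?thesis
      using alg_mult_eq_count_roots[OF P] by (metis One_nat_def Suc_1 Suc_leI le_antisym not_less_eq_eq)
  qed
  have set: "set_mset (roots P) = {x \<in> carrier L. x [^] q = x}"
    using roots_mem_iff_is_root[OF P] root by auto
  \<comment> \<open>All multiplicities are \<open>1\<close>, so the multiset of roots has as many
    elements as its support; over an algebraically closed field its size is the degree
    \<open>q\<close>.\<close>
  have "size (roots P) = card (set_mset (roots P))"
    unfolding size_multiset_overloaded_eq
    using simple roots_mem_iff_is_root[OF P] by simp
  then show ?thesis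
    using roots_over_carrier[OF P] deg set by (simp add: splitted_def q_def)
qed

text \<open>\<open>K\<close> is the set of fixed points of \<open>x^(p^m)\<close> in an algebraic
  closure of the prime field; the element type is the one of that closure. Only cancellation is
  needed later, so it is recorded as a domain.\<close>

lemma exists_finite_domain_of_order_prime_power:
  assumes p: "prime (p::nat)" and "m > 0"
  shows "\<exists>K :: (((int list \<times> nat) multiset) \<Rightarrow> int) ring.
    domain K \<and> card (carrier K) = p ^ m \<and> [p] \<cdot>\<^bsub>K\<^esub> \<one>\<^bsub>K\<^esub> = \<zero>\<^bsub>K\<^esub>"
proof -
  interpret R: residues_prime p "residue_ring (int p)"
    using p by unfold_locales simp_all
  obtain L :: "(((int list \<times> nat) multiset) \<Rightarrow> int) ring"
    where L: "algebraic_closure L (R.indexed_const ` carrier (residue_ring (int p)))"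
      and hom: "R.indexed_const \<in> ring_hom (residue_ring (int p)) L"
    using R.exists_closure by blast
  interpret L: algebraic_closure L "R.indexed_const ` carrier (residue_ring (int p))"
    by (rule L)
  \<comment> \<open>The order of the additive group, here \<open>p\<close>, annihilates
    \<open>1\<close>.\<close>
  have "[(order (add_monoid (residue_ring (int p))))] \<cdot>\<^bsub>residue_ring (int p)\<^esub> \<one>\<^bsub>residue_ring (int p)\<^esub>
      = \<zero>\<^bsub>residue_ring (int p)\<^esub>"
    using R.add.pow_order_eq_1[of "\<one>\<^bsub>residue_ring (int p)\<^esub>"] by simp
  moreover have "order (add_monoid (residue_ring (int p))) = p"
    by (simp add: order_def residue_ring_def)
  ultimately have char: "[p] \<cdot>\<^bsub>L\<^esub> \<one>\<^bsub>L\<^esub> = \<zero>\<^bsub>L\<^esub>"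
    using ring_hom_char[OF R.ring_axioms L.ring_axioms hom] by simp
  let ?K = "{x \<in> carrier L. x [^]\<^bsub>L\<^esub> (p ^ m) = x}"
  note frob = L.frobenius_power_add[OF p char, of _ _ m]
  have sub: "subring ?K L"
  proof (rule L.subringI)
    fix x assume x: "x \<in> ?K"
    \<comment> \<open>Frobenius applied to \<open>x + (-x) = 0\<close> gives
      \<open>x + (-x)^q = 0\<close> with \<open>q = p^m\<close>, hence \<open>(-x)^q = -x\<close>
      without any parity argument.\<close>
    have "(x \<oplus>\<^bsub>L\<^esub> \<ominus>\<^bsub>L\<^esub> x) [^]\<^bsub>L\<^esub> (p ^ m) = \<zero>\<^bsub>L\<^esub>"
      using x p by (simp add: L.r_neg L.nat_pow_zero prime_gt_0_nat)
    then have "x \<oplus>\<^bsub>L\<^esub> (\<ominus>\<^bsub>L\<^esub> x) [^]\<^bsub>L\<^esub> (p ^ m) = \<zero>\<^bsub>L\<^esub>"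
      using x by (simp add: frob)
    then show "\<ominus>\<^bsub>L\<^esub> x \<in> ?K"
      using x by (simp add: L.add.inv_equality[symmetric] L.a_comm L.minus_equality)
  qed (auto simp: frob L.nat_pow_distrib L.nat_pow_one)
  have "[n] \<cdot>\<^bsub>L\<lparr>carrier := ?K\<rparr>\<^esub> \<one>\<^bsub>L\<^esub> = [n] \<cdot>\<^bsub>L\<^esub> \<one>\<^bsub>L\<^esub>" for n :: nat
    by (simp add: add_pow_def nat_pow_def)
  then show ?thesis
    using L.subring_is_domain[OF sub] L.card_frobenius_fixed_points[OF p char \<open>m > 0\<close>] char
    by (intro exI[of _ "L\<lparr>carrier := ?K\<rparr>"]) simp
qed

section \<open>Difference covers of finite groups\<close>

text \<open>The competitors in the definition of \<open>eta\<close>. Finiteness excludes infinite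
  sets, whose \<open>card\<close> would be \<open>0\<close>.\<close>

definition diff_cover :: "nat \<Rightarrow> ('a, 'b) monoid_scheme \<Rightarrow> 'a set \<Rightarrow> bool" where
  "diff_cover g G A \<longleftrightarrow> finite A \<and> A \<subseteq> carrier G \<and> (\<forall>x\<in>carrier G. g \<le> diff_rep G A x)"

lemma eta_le: "diff_cover g G A \<Longrightarrow> eta g G \<le> card A"
  unfolding eta_def diff_cover_def by (rule cInf_lower) auto

text \<open>A single cover makes the set of cardinalities nonempty, so its infimum is a minimum and
  not the default value \<open>0\<close>.\<close>

lemma eta_attained:
  assumes "diff_cover g G A"
  obtains B where "diff_cover g G B" "card B = eta g G"
proof -
  have "eta g G \<in> {card A | A. finite A \<and> A \<subseteq> carrier G \<and> (\<forall>x\<in>carrier G. g \<le> diff_rep G A x)}"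
    unfolding eta_def using assms by (intro Inf_nat_def1) (auto simp: diff_cover_def)
  then show thesis
    using that by (auto simp: diff_cover_def)
qed

lemma finite_diff_pairs:
  "finite A \<Longrightarrow> finite {(a, a'). a \<in> A \<and> a' \<in> A \<and> d = a \<otimes>\<^bsub>G\<^esub> inv\<^bsub>G\<^esub> a'}"
  by (rule finite_subset[of _ "A \<times> A"]) auto

lemma diff_rep_ge_1_iff:
  assumes "finite A"
  shows "1 \<le> diff_rep G A d \<longleftrightarrow> (\<exists>a\<in>A. \<exists>a'\<in>A. d = a \<otimes>\<^bsub>G\<^esub> inv\<^bsub>G\<^esub> a')"
proof -
  have "1 \<le> diff_rep G A d \<longleftrightarrow> {(a, a'). a \<in> A \<and> a' \<in> A \<and> d = a \<otimes>\<^bsub>G\<^esub> inv\<^bsub>G\<^esub> a'} \<noteq> {}"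
    unfolding diff_rep_def using finite_diff_pairs[OF assms, of d G]
    by (simp add: Suc_le_eq card_gt_0_iff)
  then show ?thesis by auto
qed

lemma diff_cover_1_iff:
  "diff_cover 1 G A \<longleftrightarrow> finite A \<and> A \<subseteq> carrier G \<and>
    (\<forall>x\<in>carrier G. \<exists>a\<in>A. \<exists>a'\<in>A. x = a \<otimes>\<^bsub>G\<^esub> inv\<^bsub>G\<^esub> a')"
  using diff_rep_ge_1_iff[of A G] by (auto simp: diff_cover_def)

text \<open>Each \<open>y\<close> gives a representation of \<open>x\<close> as the difference of
  \<open>x y\<close> and \<open>y\<close>. This supplies the cover that \<open>eta_attained\<close>
  asks for.\<close>

lemma (in group) diff_cover_carrier:
  assumes "finite (carrier G)" "g \<le> order G"
  shows "diff_cover g G (carrier G)"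
proof -
  have "order G \<le> diff_rep G (carrier G) x" if x: "x \<in> carrier G" for x
    unfolding diff_rep_def order_def
  proof (rule card_inj_on_le[of "\<lambda>y. (x \<otimes> y, y)"])
    show "(\<lambda>y. (x \<otimes> y, y)) ` carrier G \<subseteq> {(a, a'). a \<in> carrier G \<and> a' \<in> carrier G \<and> x = a \<otimes> inv a'}"
      using x by (auto simp: m_assoc)
  qed (auto simp: inj_on_def finite_diff_pairs assms(1))
  then show ?thesis
    using assms by (force simp: diff_cover_def)
qed

section \<open>Difference covers under isomorphisms and direct products\<close>

lemma diff_cover_iso_image:
  assumes "group G" "group H" and h: "h \<in> iso G H" and A: "diff_cover g G A"
  shows "diff_cover g H (h ` A)"
proof -
  interpret group_hom G H h
    using assms by (intro group_hom.intro) (auto simp: group_hom_axioms_def iso_def)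
  have inj: "inj_on h (carrier G)" and surj: "h ` carrier G = carrier H"
    using h by (auto simp: iso_def bij_betw_def)
  have A': "finite A" "A \<subseteq> carrier G"
    using A by (auto simp: diff_cover_def)
  have "diff_rep G A x \<le> diff_rep H (h ` A) (h x)" for x
    unfolding diff_rep_def
  proof (rule card_inj_on_le[of "\<lambda>(a, b). (h a, h b)"])
    show "inj_on (\<lambda>(a, b). (h a, h b)) {(a, a'). a \<in> A \<and> a' \<in> A \<and> x = a \<otimes>\<^bsub>G\<^esub> inv\<^bsub>G\<^esub> a'}"
      using A' inj by (auto simp: inj_on_def subset_iff)
    show "(\<lambda>(a, b). (h a, h b)) ` {(a, a'). a \<in> A \<and> a' \<in> A \<and> x = a \<otimes>\<^bsub>G\<^esub> inv\<^bsub>G\<^esub> a'}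
      \<subseteq> {(a, a'). a \<in> h ` A \<and> a' \<in> h ` A \<and> h x = a \<otimes>\<^bsub>H\<^esub> inv\<^bsub>H\<^esub> a'}"
      using A' by (auto simp: subset_iff)
  qed (use A' in \<open>simp add: finite_diff_pairs\<close>)
  then have "g \<le> diff_rep H (h ` A) (h x)" if "x \<in> carrier G" for x
    using A that order_trans unfolding diff_cover_def by blast
  then show ?thesis
    using A' unfolding diff_cover_def surj[symmetric] by auto
qed

lemma eta_iso_le:
  assumes "group G" "group H" "G \<cong> H" "finite (carrier G)" "g \<le> order G"
  shows "eta g H \<le> eta g G"
proof -
  obtain h where h: "h \<in> iso G H"
    using assms(3) by (auto simp: is_iso_def)
  obtain A where A: "diff_cover g G A" "card A = eta g G"
    using eta_attained[OF group.diff_cover_carrier[OF assms(1,4,5)]] .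
  have "eta g H \<le> card (h ` A)"
    using diff_cover_iso_image[OF assms(1,2) h A(1)] by (rule eta_le)
  also have "\<dots> \<le> card A"
    using A by (intro card_image_le) (simp add: diff_cover_def)
  finally show ?thesis using A by simp
qed

lemma eta_iso:
  assumes "group G" "group H" "G \<cong> H" "finite (carrier G)" "g \<le> order G"
  shows "eta g G = eta g H"
proof (rule antisym)
  have "finite (carrier H)" "g \<le> order H"
    using assms iso_finite[OF assms(3)] iso_same_card[OF assms(3)] by (auto simp: order_def)
  then show "eta g G \<le> eta g H"
    using eta_iso_le[OF assms(2,1) group.iso_sym[OF assms(1,3)]] by blast
qed (rule eta_iso_le[OF assms])

text \<open>Fix one representation of the second coordinate; each of the at least \<open>g\<close>
  representations of the first coordinate pairs with it.\<close>

lemma diff_cover_DirProd: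
  assumes "group G" "group H" and A: "diff_cover g G A" and B: "diff_cover 1 H B"
  shows "diff_cover g (G \<times>\<times> H) (A \<times> B)"
  unfolding diff_cover_def
proof (intro conjI ballI)
  show "finite (A \<times> B)" "A \<times> B \<subseteq> carrier (G \<times>\<times> H)"
    using A B by (auto simp: diff_cover_def)
  fix z assume "z \<in> carrier (G \<times>\<times> H)"
  then obtain x y where z: "z = (x, y)" "x \<in> carrier G" "y \<in> carrier H"
    by auto
  obtain b b' where b: "b \<in> B" "b' \<in> B" "y = b \<otimes>\<^bsub>H\<^esub> inv\<^bsub>H\<^esub> b'"
    using B z(3) unfolding diff_cover_1_iff by blast
  have sub: "A \<subseteq> carrier G" "B \<subseteq> carrier H"
    using A B by (auto simp: diff_cover_def)
  have "g \<le> diff_rep G A x"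
    using A z(2) by (simp add: diff_cover_def)
  also have "\<dots> \<le> diff_rep (G \<times>\<times> H) (A \<times> B) z"
    unfolding diff_rep_def
  proof (rule card_inj_on_le[of "\<lambda>(a, a'). ((a, b), (a', b'))"])
    show "(\<lambda>(a, a'). ((a, b), (a', b'))) ` {(a, a'). a \<in> A \<and> a' \<in> A \<and> x = a \<otimes>\<^bsub>G\<^esub> inv\<^bsub>G\<^esub> a'}
      \<subseteq> {(u, u'). u \<in> A \<times> B \<and> u' \<in> A \<times> B \<and> z = u \<otimes>\<^bsub>G \<times>\<times> H\<^esub> inv\<^bsub>G \<times>\<times> H\<^esub> u'}"
      using b sub assms(1,2) by (auto simp: z(1) subset_iff)
  qed (use \<open>finite (A \<times> B)\<close> in \<open>auto simp: inj_on_def finite_diff_pairs\<close>)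
  finally show "g \<le> diff_rep (G \<times>\<times> H) (A \<times> B) z" .
qed

lemma eta_DirProd_le:
  assumes "group G" "group H" "finite (carrier G)" "finite (carrier H)" "g \<le> order G"
  shows "eta g (G \<times>\<times> H) \<le> eta g G * eta 1 H"
proof -
  obtain A where A: "diff_cover g G A" "card A = eta g G"
    using eta_attained[OF group.diff_cover_carrier[OF assms(1,3,5)]] .
  have "1 \<le> order H"
    using assms(2,4) by (auto simp: order_def Suc_le_eq card_gt_0_iff dest: group.is_monoid monoid.one_closed)
  then obtain B where B: "diff_cover 1 H B" "card B = eta 1 H"
    using eta_attained[OF group.diff_cover_carrier[OF assms(2,4)]] by blast
  show ?thesis
    using eta_le[OF diff_cover_DirProd[OF assms(1,2) A(1) B(1)]] A(2) B(2)
    by (simp add: card_cartesian_product)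
qed

text \<open>The union of the two factors is a cover: \<open>(x, y)\<close> is the difference of
  \<open>(x, 1)\<close> and the inverse of \<open>(1, y)\<close>.\<close>

lemma eta_1_DirProd_le:
  assumes "group G" "group H" "finite (carrier G)" "finite (carrier H)"
  shows "eta 1 (G \<times>\<times> H) \<le> order G + order H"
proof -
  interpret G: group G by fact
  interpret H: group H by fact
  let ?A = "carrier G \<times> {\<one>\<^bsub>H\<^esub>} \<union> {\<one>\<^bsub>G\<^esub>} \<times> carrier H"
  have "diff_cover 1 (G \<times>\<times> H) ?A"
    unfolding diff_cover_1_iff
  proof (intro conjI ballI)
    fix z assume "z \<in> carrier (G \<times>\<times> H)"
    then obtain x y where z: "z = (x, y)" "x \<in> carrier G" "y \<in> carrier H"
      by auto
    then have "z = (x, \<one>\<^bsub>H\<^esub>) \<otimes>\<^bsub>G \<times>\<times> H\<^esub> inv\<^bsub>G \<times>\<times> H\<^esub> (\<one>\<^bsub>G\<^esub>, inv\<^bsub>H\<^esub> y)"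
      using assms(1,2) by simp
    then show "\<exists>a\<in>?A. \<exists>a'\<in>?A. z = a \<otimes>\<^bsub>G \<times>\<times> H\<^esub> inv\<^bsub>G \<times>\<times> H\<^esub> a'"
      using z by (metis G.one_closed H.inv_closed H.one_closed SigmaI UnI1 UnI2 singletonI)
  qed (use assms in auto)
  then have "eta 1 (G \<times>\<times> H) \<le> card ?A"
    by (rule eta_le)
  also have "\<dots> \<le> card (carrier G \<times> {\<one>\<^bsub>H\<^esub>}) + card ({\<one>\<^bsub>G\<^esub>} \<times> carrier H)"
    by (rule card_Un_le)
  finally show ?thesis
    by (simp add: card_cartesian_product order_def)
qed

text \<open>For \<open>g > 0\<close> the difference map from \<open>A \<times> A\<close> reaches
  every element of \<open>G\<close>.\<close>

lemma order_le_eta_square: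
  assumes "group G" "finite (carrier G)" "g \<le> order G" "g > 0"
  shows "order G \<le> (eta g G)\<^sup>2"
proof -
  obtain A where A: "diff_cover g G A" "card A = eta g G"
    using eta_attained[OF group.diff_cover_carrier[OF assms(1-3)]] .
  then have A1: "diff_cover 1 G A"
    using \<open>g > 0\<close> by (fastforce simp: diff_cover_def)
  then have "carrier G \<subseteq> (\<lambda>(a, a'). a \<otimes>\<^bsub>G\<^esub> inv\<^bsub>G\<^esub> a') ` (A \<times> A)"
    unfolding diff_cover_1_iff by fastforce
  moreover have "finite A"
    using A by (simp add: diff_cover_def)
  ultimately have "card (carrier G) \<le> card (A \<times> A)"
    by (intro surj_card_le) auto
  then show ?thesis
    using A(2) by (simp add: order_def card_cartesian_product power2_eq_square)
qed

text \<open>The parabola \<open>{(x, x\<^sup>2)}\<close> represents every \<open>(a, b)\<close> with \<open>a \<noteq> 0\<close> because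
  \<open>x\<^sup>2 - (x - a)\<^sup>2 = 2ax - a\<^sup>2\<close> is a bijective function of \<open>x\<close>; only the differences
  \<open>(0, b)\<close> require additional elements.\<close>

lemma eta_1_parabola_le:
  fixes K (structure)
  assumes "domain K" "finite (carrier K)"
    and two: "\<And>x. x \<in> carrier K \<Longrightarrow> x \<oplus> x = \<zero> \<Longrightarrow> x = \<zero>"
  shows "eta 1 (add_monoid K \<times>\<times> add_monoid K) \<le> card (carrier K) + eta 1 (add_monoid K)"
proof -
  interpret domain K by fact
  let ?G = "add_monoid K \<times>\<times> add_monoid K"
  have G: "group (add_monoid K)"
    by (rule a_group)
  have "1 \<le> order (add_monoid K)"
    using assms(2) by (auto simp: order_def Suc_le_eq card_gt_0_iff)
  then obtain B where B: "diff_cover 1 (add_monoid K) B" "card B = eta 1 (add_monoid K)"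
    using eta_attained[OF group.diff_cover_carrier[OF G]] assms(2) by auto
  have B': "finite B" "B \<subseteq> carrier K"
    using B by (auto simp: diff_cover_def)
  have dif: "u \<otimes>\<^bsub>?G\<^esub> inv\<^bsub>?G\<^esub> v = (fst u \<ominus> fst v, snd u \<ominus> snd v)"
    if "u \<in> carrier K \<times> carrier K" "v \<in> carrier K \<times> carrier K" for u v
    using that G by (cases u; cases v) (simp add: a_minus_def a_inv_def)
  \<comment> \<open>\<open>?A\<close> is the parabola; \<open>?B\<close> is a minimal cover of
    \<open>K\<close> placed on the line of first coordinate zero.\<close>
  let ?A = "(\<lambda>x. (x, x \<otimes> x)) ` carrier K" and ?B = "Pair \<zero> ` B"
  have "diff_cover 1 ?G (?A \<union> ?B)"
    unfolding diff_cover_1_iff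
  proof (intro conjI ballI)
    show "finite (?A \<union> ?B)" "?A \<union> ?B \<subseteq> carrier ?G"
      using B' assms(2) by auto
    fix z assume "z \<in> carrier ?G"
    then obtain a b where z: "z = (a, b)" "a \<in> carrier K" "b \<in> carrier K"
      by auto
    show "\<exists>u\<in>?A \<union> ?B. \<exists>v\<in>?A \<union> ?B. z = u \<otimes>\<^bsub>?G\<^esub> inv\<^bsub>?G\<^esub> v"
    proof (cases "a = \<zero>")
      case True
      obtain u v where uv: "u \<in> B" "v \<in> B" "b = u \<ominus> v"
        using B(1) z(3) unfolding diff_cover_1_iff by (auto simp: a_minus_def a_inv_def)
      then have "z = (\<zero>, u) \<otimes>\<^bsub>?G\<^esub> inv\<^bsub>?G\<^esub> (\<zero>, v)"
        using True B' z by (subst dif) (auto simp: subset_iff a_minus_def)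
      then show ?thesis
        using uv by blast
    next
      case False
      \<comment> \<open>\<open>f x\<close> is the second coordinate of the difference of the
        parabola points over \<open>x + a\<close> and \<open>x\<close>. It is affine with slope
        \<open>2a\<close>, nonzero by \<open>two\<close>, hence injective, hence onto the finite
        carrier.\<close>
      define f where "f = (\<lambda>x. (x \<oplus> a) \<otimes> (x \<oplus> a) \<ominus> x \<otimes> x)"
      have f: "f x = (a \<oplus> a) \<otimes> x \<oplus> a \<otimes> a" if "x \<in> carrier K" for x
        using that z(2) unfolding f_def by algebra
      have "inj_on f (carrier K)"
      proof (rule inj_onI)
        fix x y assume xy: "x \<in> carrier K" "y \<in> carrier K" "f x = f y"
        then have "(a \<oplus> a) \<otimes> x = (a \<oplus> a) \<otimes> y"
          using z(2) by (simp add: f add.right_cancel)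
        moreover have "a \<oplus> a \<noteq> \<zero>"
          using two z(2) False by blast
        ultimately show "x = y"
          using xy z(2) by (simp add: m_lcancel)
      qed
      moreover have "f ` carrier K \<subseteq> carrier K"
        using z(2) by (auto simp: f_def)
      ultimately have "f ` carrier K = carrier K"
        using assms(2) by (intro endo_inj_surj)
      then obtain x where x: "x \<in> carrier K" "b = f x"
        using z(3) by blast
      have "a = (x \<oplus> a) \<ominus> x"
        using x z(2) by algebra
      then have "z = (x \<oplus> a, (x \<oplus> a) \<otimes> (x \<oplus> a)) \<otimes>\<^bsub>?G\<^esub> inv\<^bsub>?G\<^esub> (x, x \<otimes> x)"
        using x z by (subst dif) (auto simp: f_def)
      then show ?thesis
        using x z(2) by blast
    qed
  qed
  then have "eta 1 ?G \<le> card (?A \<union> ?B)"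
    by (rule eta_le)
  also have "\<dots> \<le> card ?A + card ?B"
    by (rule card_Un_le)
  also have "\<dots> \<le> card (carrier K) + card B"
    using assms(2) B' by (intro add_mono card_image_le)
  finally show ?thesis
    using B(2) by simp
qed

section \<open>Elementary abelian groups\<close>

lemma carrier_Fp_space: "carrier (Fp_space p n) = (\<Pi>\<^sub>E i\<in>{..<n}. {0..int p - 1})"
  by (simp add: Fp_space_def residue_ring_def)

lemma one_Fp_space: "\<one>\<^bsub>Fp_space p n\<^esub> = (\<lambda>i\<in>{..<n}. 0)"
  by (simp add: Fp_space_def residue_ring_def)

lemma mult_Fp_space: "x \<otimes>\<^bsub>Fp_space p n\<^esub> y = (\<lambda>i\<in>{..<n}. (x i + y i) mod int p)"
  by (simp add: Fp_space_def residue_ring_def)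

lemma group_Fp_space: "prime p \<Longrightarrow> group (Fp_space p n)"
  using comm_group_Fp_space comm_group.axioms(2) by blast

lemma finite_Fp_space: "finite (carrier (Fp_space p n))"
  by (simp add: carrier_Fp_space finite_PiE)

lemma Fp_space_exponent:
  assumes "prime p" and x: "x \<in> carrier (Fp_space p n)"
  shows "x [^]\<^bsub>Fp_space p n\<^esub> p = \<one>\<^bsub>Fp_space p n\<^esub>"
proof -
  have "x [^]\<^bsub>Fp_space p n\<^esub> k = (\<lambda>i\<in>{..<n}. (int k * x i) mod int p)" for k
  proof (induction k)
    case 0
    then show ?case by (simp add: one_Fp_space cong: restrict_cong)
  next
    case (Suc k)
    then show ?case
      by (auto simp: mult_Fp_space mod_simps algebra_simps cong: restrict_cong)
  qed
  then show ?thesis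
    by (simp add: one_Fp_space cong: restrict_cong)
qed

text \<open>As long as the image of an injection of \<open>F\<^sub>p\<^sup>j\<close> is proper, any element outside it serves as
  the image of the next basis vector.\<close>

lemma exists_inj_hom_Fp_space:
  fixes G (structure)
  assumes p: "prime p" and "comm_group G" and ord: "order G = p ^ n"
    and exponent: "\<And>x. x \<in> carrier G \<Longrightarrow> x [^] p = \<one>" and "j \<le> n"
  shows "\<exists>h \<in> hom (Fp_space p j) G. inj_on h (carrier (Fp_space p j))"
  using \<open>j \<le> n\<close>
proof (induction j)
  interpret comm_group G by fact
  case 0
  show ?case
    by (intro bexI[of _ "\<lambda>_. \<one>"] homI) (auto simp: carrier_Fp_space)
next
  interpret comm_group G by fact
  case (Suc j)
  then obtain h where h: "h \<in> hom (Fp_space p j) G" and inj: "inj_on h (carrier (Fp_space p j))"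
    by auto
  interpret h: group_hom "Fp_space p j" G h
    using h group_Fp_space[OF p] by (simp add: group_hom_def group_hom_axioms_def)
  define I where "I = h ` carrier (Fp_space p j)"
  have I: "subgroup I G"
    unfolding I_def by (rule h.img_is_subgroup)
  \<comment> \<open>The image has order \<open>p^j\<close> with \<open>j < n\<close>, so it is
    proper and leaves room for \<open>b\<close>.\<close>
  have "card I = p ^ j"
    unfolding I_def card_image[OF inj] using order_Fp_space[of p j] by (simp add: order_def)
  also have "\<dots> < card (carrier G)"
    using ord prime_gt_1_nat[OF p] Suc.prems by (simp add: order_def power_strict_increasing)
  finally have "I \<noteq> carrier G"
    by auto
  then obtain b where b: "b \<in> carrier G" "b \<notin> I"
    using subgroup.subset[OF I] by blast
  \<comment> \<open>The order of \<open>b\<close> divides \<open>p\<close>, so exponents of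
    \<open>b\<close> count only modulo \<open>p\<close>. Hence \<open>h'\<close> below respects the
    reduction in the last coordinate.\<close>
  have pow_eq: "b [^] k = b [^] l" if "int p dvd l - k" for k l :: int
  proof -
    have "int (Multiplicative_Group.group.ord G b) dvd int p"
      using exponent[OF b(1)] pow_eq_id[OF b(1)] by simp
    then show ?thesis
      unfolding int_pow_eq[OF b(1)] using that by (rule dvd_trans)
  qed
  define h' where "h' = (\<lambda>f. h (restrict f {..<j}) \<otimes> b [^] (f j :: int))"
  have restr: "restrict f {..<j} \<in> carrier (Fp_space p j)" if "f \<in> carrier (Fp_space p (Suc j))" for f
    using that by (fastforce simp: carrier_Fp_space PiE_iff)
  have h': "h' \<in> hom (Fp_space p (Suc j)) G"
  proof (rule homI)
    fix x y assume xy: "x \<in> carrier (Fp_space p (Suc j))" "y \<in> carrier (Fp_space p (Suc j))"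
    have "restrict (x \<otimes>\<^bsub>Fp_space p (Suc j)\<^esub> y) {..<j} = restrict x {..<j} \<otimes>\<^bsub>Fp_space p j\<^esub> restrict y {..<j}"
      by (auto simp: mult_Fp_space restrict_def)
    moreover have "b [^] ((x j + y j) mod int p) = b [^] x j \<otimes> b [^] y j"
      using pow_eq[of "x j + y j" "(x j + y j) mod int p"] b(1)
      by (simp add: int_pow_mult[symmetric] dvd_minus_mod dvd_diff_commute mod_eq_dvd_iff[symmetric])
    ultimately show "h' (x \<otimes>\<^bsub>Fp_space p (Suc j)\<^esub> y) = h' x \<otimes> h' y"
      using restr[OF xy(1)] restr[OF xy(2)] b(1) by (simp add: h'_def mult_Fp_space[of _ "Suc j"] m_ac)
  qed (use restr b(1) in \<open>simp add: h'_def\<close>)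
  interpret h': group_hom "Fp_space p (Suc j)" G h'
    using h' group_Fp_space[OF p] by (simp add: group_hom_def group_hom_axioms_def)
  have "inj_on h' (carrier (Fp_space p (Suc j)))"
    unfolding h'.inj_on_one_iff
  proof (intro allI impI)
    fix f assume f: "f \<in> carrier (Fp_space p (Suc j))" and 1: "h' f = \<one>"
    have fj: "0 \<le> f j" "f j < int p"
      using f by (auto simp: carrier_Fp_space PiE_iff)
    have hI: "h (restrict f {..<j}) \<in> I"
      using restr[OF f] by (simp add: I_def)
    \<comment> \<open>For \<open>f\<close> in the kernel the power of \<open>b\<close> lies in
      \<open>I\<close>. A nonzero exponent \<open>f j\<close> would be invertible modulo
      \<open>p\<close>, which would put \<open>b\<close> itself into \<open>I\<close>.\<close>
    have "b [^] f j = inv (h (restrict f {..<j}))"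
      using 1 restr[OF f] b(1) unfolding h'_def by (intro inv_equality[symmetric]) (auto simp: m_comm)
    then have bI: "b [^] f j \<in> I"
      using hI subgroup.m_inv_closed[OF I] by simp
    have "f j = 0"
    proof (rule ccontr)
      assume "f j \<noteq> 0"
      then have "\<not> int p dvd f j"
        using fj zdvd_not_zless by auto
      then have "coprime (f j) (int p)"
        using p prime_imp_coprime[of "int p" "f j"] by (simp add: coprime_commute)
      then obtain c where "[f j * c = 1] (mod int p)"
        using cong_solve_coprime_int by blast
      then have "b [^] (f j * c) = b [^] (1::int)"
        by (intro pow_eq) (simp add: cong_iff_dvd_diff dvd_diff_commute)
      then have "b = (b [^] f j) [^] c"
        using b(1) by (simp add: int_pow_pow)
      moreover have "(b [^] f j) [^] c \<in> I"
        using I bI by (rule subgroup_int_pow_closed)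
      ultimately show False
        using b(2) by simp
    qed
    then have "h (restrict f {..<j}) = \<one>"
      using 1 restr[OF f] by (simp add: h'_def)
    then have "restrict f {..<j} = \<one>\<^bsub>Fp_space p j\<^esub>"
      using inj restr[OF f] by (auto simp: h.inj_on_one_iff)
    then have "f i = 0" if "i < j" for i
      using that by (metis lessThan_iff one_Fp_space restrict_apply')
    then show "f = \<one>\<^bsub>Fp_space p (Suc j)\<^esub>"
      using f \<open>f j = 0\<close>
      by (intro extensionalityI[of f "{..<Suc j}"]) (auto simp: one_Fp_space carrier_Fp_space PiE_iff less_Suc_eq)
  qed
  then show ?case
    using h' by blast
qed

text \<open>At \<open>j = n\<close> the injection is onto because the orders agree.\<close>

lemma Fp_space_iso_elementary_abelian:
  fixes G (structure)
  assumes p: "prime p" and "comm_group G" and ord: "order G = p ^ n"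
    and exponent: "\<And>x. x \<in> carrier G \<Longrightarrow> x [^] p = \<one>"
  shows "Fp_space p n \<cong> G"
proof -
  obtain h where h: "h \<in> hom (Fp_space p n) G" "inj_on h (carrier (Fp_space p n))"
    using exists_inj_hom_Fp_space[OF assms order_refl] by blast
  have "finite (carrier G)"
    using ord p by (metis card.infinite order_def not_prime_0 power_not_zero)
  moreover have "card (h ` carrier (Fp_space p n)) = card (carrier G)"
    using ord order_Fp_space[of p n] by (simp add: order_def card_image[OF h(2)])
  moreover have "h ` carrier (Fp_space p n) \<subseteq> carrier G"
    using h(1) by (auto simp: hom_def)
  ultimately have "h ` carrier (Fp_space p n) = carrier G"
    by (intro card_subset_eq)
  then show ?thesis
    using h by (intro is_isoI[of h] isoI) (auto simp: bij_betw_def)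
qed

text \<open>The product has order \<open>p^(m+n)\<close> and exponent \<open>p\<close>, so the
  preceding classification replaces an explicit splitting of coordinates.\<close>

lemma Fp_space_add_iso:
  assumes "prime p"
  shows "Fp_space p (m + n) \<cong> Fp_space p m \<times>\<times> Fp_space p n"
proof (rule Fp_space_iso_elementary_abelian[OF assms])
  interpret M: comm_group "Fp_space p m" by (rule comm_group_Fp_space[OF assms])
  interpret N: comm_group "Fp_space p n" by (rule comm_group_Fp_space[OF assms])
  interpret group "Fp_space p m \<times>\<times> Fp_space p n"
    by (rule DirProd_group) (rule M.group_axioms N.group_axioms)+
  show "comm_group (Fp_space p m \<times>\<times> Fp_space p n)"
    by (rule group_comm_groupI) (auto simp: M.m_comm N.m_comm)
  show "order (Fp_space p m \<times>\<times> Fp_space p n) = p ^ (m + n)"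
    using order_Fp_space[of p m] order_Fp_space[of p n]
    by (simp add: order_def card_cartesian_product power_add)
  fix x assume x: "x \<in> carrier (Fp_space p m \<times>\<times> Fp_space p n)"
  have "x [^]\<^bsub>Fp_space p m \<times>\<times> Fp_space p n\<^esub> k = (fst x [^]\<^bsub>Fp_space p m\<^esub> k, snd x [^]\<^bsub>Fp_space p n\<^esub> k)" for k :: nat
    by (induction k) (auto simp: mult_DirProd')
  then show "x [^]\<^bsub>Fp_space p m \<times>\<times> Fp_space p n\<^esub> p = \<one>\<^bsub>Fp_space p m \<times>\<times> Fp_space p n\<^esub>"
    using x Fp_space_exponent[OF assms] by auto
qed

section \<open>Bounds for \<open>eta\<close> on \<open>F_p^n\<close>\<close>

lemma one_le_order_Fp_space: "prime p \<Longrightarrow> 1 \<le> order (Fp_space p n)"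
  by (simp add: order_Fp_space prime_gt_0_nat Suc_le_eq)

lemma eta_Fp_space_add_le:
  assumes "prime p" "g \<le> p ^ m"
  shows "eta g (Fp_space p (m + n)) \<le> eta g (Fp_space p m) * eta 1 (Fp_space p n)"
proof -
  have "g \<le> order (Fp_space p (m + n))"
    using assms power_increasing[of m "m + n" p] prime_ge_1_nat[of p] by (simp add: order_Fp_space)
  then have "eta g (Fp_space p (m + n)) = eta g (Fp_space p m \<times>\<times> Fp_space p n)"
    using assms(1) by (intro eta_iso Fp_space_add_iso DirProd_group group_Fp_space finite_Fp_space)
  also have "\<dots> \<le> eta g (Fp_space p m) * eta 1 (Fp_space p n)"
    using assms by (intro eta_DirProd_le group_Fp_space finite_Fp_space) (simp_all add: order_Fp_space)
  finally show ?thesis .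
qed

lemma eta_1_Fp_space_add_le:
  assumes "prime p"
  shows "eta 1 (Fp_space p (m + n)) \<le> p ^ m + p ^ n"
proof -
  have "eta 1 (Fp_space p (m + n)) = eta 1 (Fp_space p m \<times>\<times> Fp_space p n)"
    using assms
    by (intro eta_iso Fp_space_add_iso DirProd_group group_Fp_space finite_Fp_space one_le_order_Fp_space)
  also have "\<dots> \<le> p ^ m + p ^ n"
    using eta_1_DirProd_le[of "Fp_space p m" "Fp_space p n"] assms
    by (simp add: group_Fp_space finite_Fp_space order_Fp_space)
  finally show ?thesis .
qed

text \<open>\<open>F_p^m\<close> is the additive group of a domain \<open>K\<close> with
  \<open>p^m\<close> elements, so the parabola in \<open>K \<times> K\<close> applies.\<close>

lemma eta_1_Fp_space_double_le:
  assumes p: "prime p" and "odd p" and "m > 0"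
  shows "eta 1 (Fp_space p (2 * m)) \<le> p ^ m + eta 1 (Fp_space p m)"
proof -
  obtain K :: "(((int list \<times> nat) multiset) \<Rightarrow> int) ring"
    where K: "domain K" and card: "card (carrier K) = p ^ m"
      and char: "[p] \<cdot>\<^bsub>K\<^esub> \<one>\<^bsub>K\<^esub> = \<zero>\<^bsub>K\<^esub>"
    using exists_finite_domain_of_order_prime_power[OF p \<open>m > 0\<close>] by blast
  interpret K: domain K by (rule K)
  have fin: "finite (carrier K)"
    using card p by (metis card.infinite not_prime_0 power_not_zero)
  have pK: "[p] \<cdot>\<^bsub>K\<^esub> x = \<zero>\<^bsub>K\<^esub>" if "x \<in> carrier K" for x
    using K.add_pow_eq_zero_of_char[OF char dvd_refl that] .
  have two: "x = \<zero>\<^bsub>K\<^esub>" if x: "x \<in> carrier K" "x \<oplus>\<^bsub>K\<^esub> x = \<zero>\<^bsub>K\<^esub>" for x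
  proof -
    \<comment> \<open>With \<open>p = 2k + 1\<close>, the relation \<open>2x = 0\<close> turns
      \<open>p x = 0\<close> into \<open>x = 0\<close>.\<close>
    obtain k where k: "p = 2 * k + 1"
      using \<open>odd p\<close> by (elim oddE)
    have "[(2 * k)] \<cdot>\<^bsub>K\<^esub> x = [k] \<cdot>\<^bsub>K\<^esub> ([(2::nat)] \<cdot>\<^bsub>K\<^esub> x)"
      using x by (simp add: K.add.nat_pow_pow)
    also have "[(2::nat)] \<cdot>\<^bsub>K\<^esub> x = \<zero>\<^bsub>K\<^esub>"
      using x by (simp add: numeral_2_eq_2)
    finally show ?thesis
      using pK[OF x(1)] x unfolding k by (simp flip: K.add.nat_pow_mult)
  qed
  have iso: "Fp_space p m \<cong> add_monoid K"
    using p K.a_comm_group card pK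
    by (intro Fp_space_iso_elementary_abelian) (auto simp: order_def add_pow_def)
  then have "Fp_space p m \<times>\<times> Fp_space p m \<cong> add_monoid K \<times>\<times> add_monoid K"
    by (meson group.DirProd_iso_trans group_Fp_space p)
  then have "Fp_space p (2 * m) \<cong> add_monoid K \<times>\<times> add_monoid K"
    using iso_trans[OF Fp_space_add_iso[OF p, of m m]] by (simp add: mult_2)
  then have "eta 1 (Fp_space p (2 * m)) = eta 1 (add_monoid K \<times>\<times> add_monoid K)"
    using p K.a_group
    by (intro eta_iso DirProd_group group_Fp_space finite_Fp_space one_le_order_Fp_space)
  also have "\<dots> \<le> p ^ m + eta 1 (add_monoid K)"
    using eta_1_parabola_le[OF K fin two] card by simp
  also have "eta 1 (add_monoid K) = eta 1 (Fp_space p m)"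
    using p K.a_group iso
    by (intro eta_iso[symmetric] group_Fp_space finite_Fp_space one_le_order_Fp_space)
  finally show ?thesis .
qed

text \<open>The parabola costs \<open>p^m\<close>, and the line left over costs at most
  \<open>p^a + p^b\<close> for any splitting \<open>m = a + b\<close>. The nearly equal halves give
  the relative error \<open>2 / p^a\<close>, since \<open>p^b / p^m = 1 / p^a\<close>.\<close>

lemma eta_1_Fp_space_asymp:
  assumes "prime p" "odd p" "m > 0"
  shows "real (eta 1 (Fp_space p (2 * m))) / real p ^ m \<le> 1 + 2 / real p ^ (m div 2)"
proof -
  define a b where "a = m div 2" and "b = m - m div 2"
  have m: "m = a + b" and "a \<le> b"
    by (auto simp: a_def b_def)
  have p: "real p \<ge> 1"
    using assms(1) prime_ge_1_nat by simp
  have "eta 1 (Fp_space p (2 * m)) \<le> p ^ m + (p ^ a + p ^ b)"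
    using eta_1_Fp_space_double_le[OF assms] eta_1_Fp_space_add_le[OF assms(1), of a b] m by simp
  then have "real (eta 1 (Fp_space p (2 * m))) \<le> real p ^ m + (real p ^ a + real p ^ b)"
    by (metis of_nat_add of_nat_le_iff of_nat_power)
  also have "\<dots> \<le> real p ^ m + 2 * real p ^ b"
    using power_increasing[OF \<open>a \<le> b\<close> p] by simp
  also have "\<dots> = (1 + 2 / real p ^ a) * real p ^ m"
    using p by (simp add: m power_add field_simps)
  finally show ?thesis
    using p by (simp add: a_def divide_le_eq)
qed

section \<open>Convergence\<close>

text \<open>The limit is the infimum of \<open>u\<close> beyond \<open>N\<close>. Once some
  \<open>u k\<close> is below \<open>a\<close>, the bound \<open>u k * (1 + e m)\<close> drops below
  \<open>a\<close> for large \<open>m\<close>; this works because the error depends on the step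
  length \<open>m\<close> only.\<close>

lemma tendsto_of_asymp_decreasing:
  fixes u e :: "nat \<Rightarrow> real"
  assumes lower: "\<And>k. k \<ge> N \<Longrightarrow> c \<le> u k"
    and step: "\<And>k m. k \<ge> N \<Longrightarrow> m > 0 \<Longrightarrow> u (k + m) \<le> u k * (1 + e m)"
    and e: "e \<longlonglongrightarrow> 0"
  shows "\<exists>L\<ge>c. u \<longlonglongrightarrow> L"
proof (intro exI conjI)
  let ?L = "Inf (u ` {N..})"
  have bdd: "bdd_below (u ` {N..})"
    using lower by (auto intro!: bdd_belowI)
  show "c \<le> ?L"
    using lower by (intro cInf_greatest) auto
  show "u \<longlonglongrightarrow> ?L"
  proof (rule order_tendstoI)
    fix a assume "a < ?L"
    then have "a < u k" if "k \<ge> N" for k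
      using cInf_lower[OF _ bdd, of "u k"] that by force
    then show "eventually (\<lambda>k. a < u k) sequentially"
      using eventually_sequentially by blast
  next
    fix a assume "?L < a"
    then obtain k where k: "k \<ge> N" "u k < a"
      using cInf_lessD[of "u ` {N..}" a] by auto
    have "(\<lambda>m. u k * (1 + e m)) \<longlonglongrightarrow> u k * (1 + 0)"
      using e by (intro tendsto_intros)
    then have "eventually (\<lambda>m. u k * (1 + e m) < a) sequentially"
      using k by (intro order_tendstoD(2)) auto
    then have "eventually (\<lambda>m. u (m + k) < a) sequentially"
      using eventually_gt_at_top[of 0]
    proof eventually_elim
      case (elim m)
      then show ?case
        using step[OF k(1), of m] by (simp add: add.commute)
    qed
    then show "eventually (\<lambda>m. u m < a) sequentially"
      by (rule eventually_sequentially_seg[of "\<lambda>m. u m < a", THEN iffD1])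
  qed
qed

theorem theorem2:
  fixes p g :: nat
  assumes "prime p" and "odd p" and "g > 0"
  shows "\<exists>L\<^sub>e L\<^sub>o :: real.
    (\<lambda>k. real (eta g (Fp_space p (2 * k))) / sqrt (real p ^ (2 * k))) \<longlonglongrightarrow> L\<^sub>e \<and>
    (\<lambda>k. real (eta g (Fp_space p (2 * k + 1))) / sqrt (real p ^ (2 * k + 1))) \<longlonglongrightarrow> L\<^sub>o \<and>
    L\<^sub>e > 0 \<and> L\<^sub>o > 0"
proof -
  have p: "real p > 1" "p \<ge> 2"
    using assms(1) prime_gt_1_nat prime_ge_2_nat by auto
  define v where "v n = real (eta g (Fp_space p n)) / sqrt (real p ^ n)" for n
  \<comment> \<open>From \<open>n < 2^n \<le> p^n\<close>. In this range covers exist, so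
    \<open>eta\<close> is a true minimum.\<close>
  have large: "g \<le> p ^ n" if "n \<ge> g" for n
    using that less_exp[of n] power_mono[of 2 p n] p(2) by linarith
  have lower: "1 \<le> v n" if "n \<ge> g" for n
  proof -
    have "p ^ n \<le> (eta g (Fp_space p n))\<^sup>2"
      using order_le_eta_square[of "Fp_space p n" g] large[OF that] assms
      by (simp add: group_Fp_space finite_Fp_space order_Fp_space)
    then have "real p ^ n \<le> (real (eta g (Fp_space p n)))\<^sup>2"
      by (metis of_nat_le_iff of_nat_power)
    then have "sqrt (real p ^ n) \<le> real (eta g (Fp_space p n))"
      by (simp add: real_le_lsqrt)
    then show ?thesis
      using p by (simp add: v_def le_divide_eq)
  qed
  \<comment> \<open>Adjoining \<open>F_p^(2m)\<close> preserves the parity of the dimension and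
    multiplies the normalization by exactly \<open>p^m\<close>.\<close>
  have step: "v (n + 2 * m) \<le> v n * (1 + 2 / real p ^ (m div 2))" if "n \<ge> g" "m > 0" for n m
  proof -
    have s: "sqrt (real p ^ (n + 2 * m)) = sqrt (real p ^ n) * real p ^ m"
      using p by (simp add: power_add real_sqrt_mult power_mult power2_eq_square real_sqrt_power flip: power_mult_distrib)
    have "real (eta g (Fp_space p (n + 2 * m))) \<le> real (eta g (Fp_space p n)) * real (eta 1 (Fp_space p (2 * m)))"
      using eta_Fp_space_add_le[OF assms(1) large[OF that(1)], of "2 * m"] by (metis of_nat_le_iff of_nat_mult)
    then have "v (n + 2 * m) \<le> v n * (real (eta 1 (Fp_space p (2 * m))) / real p ^ m)"
      unfolding v_def s using p by (simp add: divide_right_mono)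
    also have "\<dots> \<le> v n * (1 + 2 / real p ^ (m div 2))"
      using eta_1_Fp_space_asymp[OF assms(1,2) that(2)] lower[OF that(1)] by (intro mult_left_mono) auto
    finally show ?thesis .
  qed
  \<comment> \<open>The halved exponents tend to infinity, so the error is a null geometric sequence
    along them.\<close>
  have "filterlim (\<lambda>m::nat. m div 2) at_top sequentially"
    unfolding filterlim_at_top eventually_sequentially
    by (metis div_le_mono nonzero_mult_div_cancel_left zero_neq_numeral)
  then have "(\<lambda>m. 2 * (inverse (real p)) ^ (m div 2)) \<longlonglongrightarrow> 2 * 0"
    using p by (intro tendsto_intros filterlim_compose[OF LIMSEQ_power_zero]) (auto simp: inverse_less_1_iff)
  then have e: "(\<lambda>m. 2 / real p ^ (m div 2)) \<longlonglongrightarrow> 0"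
    by (simp add: power_inverse divide_inverse)
  \<comment> \<open>Both parities at once: \<open>r = 0\<close> and \<open>r = 1\<close>. The
    threshold \<open>g\<close> suffices since \<open>2 * k + r \<ge> k\<close>, and the lower bound
    \<open>1\<close> makes both limits positive.\<close>
  have "\<exists>L\<ge>1. (\<lambda>k. v (2 * k + r)) \<longlonglongrightarrow> L" for r
  proof (rule tendsto_of_asymp_decreasing[where N = g, OF _ _ e])
    fix k m :: nat assume "g \<le> k" "0 < m"
    then show "v (2 * (k + m) + r) \<le> v (2 * k + r) * (1 + 2 / real p ^ (m div 2))"
      using step[of "2 * k + r" m] by (simp add: algebra_simps)
  qed (use lower in auto)
  from this[of 0] this[of 1] obtain L\<^sub>e L\<^sub>o
    where "(\<lambda>k. v (2 * k)) \<longlonglongrightarrow> L\<^sub>e" "(\<lambda>k. v (2 * k + 1)) \<longlonglongrightarrow> L\<^sub>o" "L\<^sub>e \<ge> 1" "L\<^sub>o \<ge> 1"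
    by auto
  then show ?thesis
    unfolding v_def by (intro exI[of _ L\<^sub>e] exI[of _ L\<^sub>o]) auto
qed

end
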